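(* Let $p\geq2$ be an integer and $0\leq\alpha\leq p-1$. If $\alpha\in\{0,1,\ldots,p-1\}$, then $B^\ast(\alpha)$ is a countable set; otherwise $B^\ast(\alpha)=\emptyset$. Hence $\dim_H B^\ast(\alpha)=0$ for every $0\leq\alpha\leq p-1$.
   Context: Each $x\in[0,1]$ is written in its $p$-adic expansion $x=0.x_1x_2\ldots$ with digits in $\{0,\ldots,p-1\}$ (non-terminating expansions); $S_n(x)=\sum_{i=1}^nx_i$; $T(0.x_1x_2x_3\ldots)=0.x_2x_3\ldots$. The moving digit mean is $M(x)=\lim_{n\to\infty}\lim_{m\to\infty}S_n(T^mx)/n$ when these limits exist, and $B^\ast(\alpha)=\{x\in[0,1]\colon M(x)=\alpha\}$ (the set of $x$ for which the limits exist and equal $\alpha$). $\dim_H$ is Hausdorff dimension. *)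

theory Defs
  imports "HOL-Analysis.Analysis"
begin

text \<open>
  Digit sequences are indexed from \<open>0\<close>: \<open>d i\<close> stands for the digit \<open>x\<^sub>i\<^sub>+\<^sub>1\<close>,
  the coefficient of \<open>p\<^sup>-\<^sup>(\<^sup>i\<^sup>+\<^sup>1\<^sup>)\<close>.  The number \<open>0\<close> has only the all-zero expansion, so the
  requirement that expansions do not terminate applies to \<open>x \<noteq> 0\<close>.
\<close>

definition nonterminating_expansion :: "nat \<Rightarrow> real \<Rightarrow> (nat \<Rightarrow> nat) \<Rightarrow> bool" where
  "nonterminating_expansion p x d \<longleftrightarrow>
     (\<forall>i. d i \<in> {0..p - 1}) \<and>
     (\<lambda>i. real (d i) / real p ^ (i + 1)) sums x \<and>
     (x \<noteq> 0 \<longrightarrow> infinite {i. d i \<noteq> 0})"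

definition digits :: "nat \<Rightarrow> real \<Rightarrow> nat \<Rightarrow> nat" where
  "digits p x = (THE d. nonterminating_expansion p x d)"

definition digit_sum :: "nat \<Rightarrow> nat \<Rightarrow> real \<Rightarrow> nat" where
  "digit_sum p n x = (\<Sum>i<n. digits p x i)"

definition shift_map :: "nat \<Rightarrow> real \<Rightarrow> real" where
  "shift_map p x = (\<Sum>i. real (digits p x (i + 1)) / real p ^ (i + 1))"

text \<open>
  \<open>L n\<close> is the inner limit for window length \<open>n\<close>; it has to exist for every \<open>n \<ge> 1\<close>.
\<close>

definition has_moving_digit_mean :: "nat \<Rightarrow> real \<Rightarrow> real \<Rightarrow> bool" where
  "has_moving_digit_mean p x \<alpha> \<longleftrightarrow>
     (\<exists>L :: nat \<Rightarrow> real.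
        (\<forall>n\<ge>1. (\<lambda>m. real (digit_sum p n ((shift_map p ^^ m) x)) / real n) \<longlonglongrightarrow> L n) \<and>
        L \<longlonglongrightarrow> \<alpha>)"

definition Bstar :: "nat \<Rightarrow> real \<Rightarrow> real set" where
  "Bstar p \<alpha> = {x \<in> {0..1}. has_moving_digit_mean p x \<alpha>}"

text \<open>
  The conventions \<open>|\<emptyset>|\<^sup>s = 0\<close> and \<open>|U|\<^sup>0 = 1\<close> for \<open>U \<noteq> \<emptyset>\<close> make the \<open>0\<close>-dimensional
  measure the counting measure; \<open>powr\<close> alone would not, since \<open>0 powr 0 = 0\<close>.
\<close>

definition diam_powr :: "real \<Rightarrow> 'a::metric_space set \<Rightarrow> real" where
  "diam_powr s U = (if U = {} then 0 else if s = 0 then 1 else diameter U powr s)"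

definition hausdorff_premeasure :: "real \<Rightarrow> real \<Rightarrow> 'a::metric_space set \<Rightarrow> ennreal" where
  "hausdorff_premeasure s \<delta> A =
     (INF U \<in> {U :: nat \<Rightarrow> 'a set. A \<subseteq> (\<Union>i. U i) \<and> (\<forall>i. bounded (U i) \<and> diameter (U i) \<le> \<delta>)}.
        \<Sum>i. ennreal (diam_powr s (U i)))"

definition hausdorff_measure :: "real \<Rightarrow> 'a::metric_space set \<Rightarrow> ennreal" where
  "hausdorff_measure s A = (SUP \<delta>\<in>{0<..}. hausdorff_premeasure s \<delta> A)"

definition hausdorff_dim :: "'a::metric_space set \<Rightarrow> ennreal" where
  "hausdorff_dim A = Inf (ennreal ` {s. 0 \<le> s \<and> hausdorff_measure s A = 0})"

lemma ceiling_eq_of_nonterminating_expansion: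
  fixes p :: nat and d :: "nat \<Rightarrow> nat"
  assumes p: "p \<ge> 2" and d: "nonterminating_expansion p x d" and x: "x \<noteq> 0"
  shows "\<lceil>real p ^ n * x\<rceil> = int (\<Sum>i<n. d i * p ^ (n - 1 - i)) + 1"
proof -
  define f where "f = (\<lambda>i. real (d i) / real p ^ (i + 1))"
  have lt: "d i \<le> p - 1" for i
    using d by (auto simp: nonterminating_expansion_def)
  have f: "f sums x" and inf: "infinite {i. d i \<noteq> 0}"
    using d x by (auto simp: nonterminating_expansion_def f_def)
  have tail: "(\<lambda>i. f (i + n)) sums (x - (\<Sum>i<n. f i))"
    using f sums_iff_shift[of f n "x - (\<Sum>i<n. f i)"] by simp
  have nonneg: "f i \<ge> 0" for i by (simp add: f_def)
  obtain k where k: "k \<ge> n" "d k \<noteq> 0"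
    using inf by (metis (mono_tags, lifting) infinite_nat_iff_unbounded_le mem_Collect_eq)
  have "0 < f (k - n + n)"
    using k p by (simp add: f_def)
  hence pos: "0 < x - (\<Sum>i<n. f i)"
    using tail nonneg by (metis suminf_pos2 sums_iff)
  have geo: "(\<lambda>i. (real p - 1) / real p ^ (n + 1) * (1 / real p) ^ i) sums
               ((real p - 1) / real p ^ (n + 1) * (1 / (1 - 1 / real p)))"
    by (intro sums_mult geometric_sums) (use p in auto)
  have "(real p - 1) / real p ^ (n + 1) * (1 / (1 - 1 / real p)) = 1 / real p ^ n"
    using p by (simp add: field_simps)
  moreover have "f (i + n) \<le> (real p - 1) / real p ^ (n + 1) * (1 / real p) ^ i" for i
  proof -
    have "real (d (i + n)) \<le> real p - 1"
      using lt[of "i + n"] p by linarith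
    hence "f (i + n) \<le> (real p - 1) / real p ^ (i + n + 1)"
      unfolding f_def by (intro divide_right_mono) auto
    thus ?thesis by (simp add: power_add power_divide mult_ac)
  qed
  ultimately have le: "x - (\<Sum>i<n. f i) \<le> 1 / real p ^ n"
    using sums_le[OF _ tail geo] by simp
  have "real p ^ n * (\<Sum>i<n. f i) = real (\<Sum>i<n. d i * p ^ (n - 1 - i))"
    unfolding sum_distrib_left of_nat_sum
  proof (rule sum.cong)
    fix i assume "i \<in> {..<n}"
    hence "n = (n - 1 - i) + (i + 1)" by simp
    hence "real p ^ n = real p ^ (n - 1 - i) * real p ^ (i + 1)"
      by (metis power_add)
    thus "real p ^ n * f i = real (d i * p ^ (n - 1 - i))"
      using p by (simp add: f_def)
  qed simp
  moreover have "real p ^ n > 0" using p by simp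
  with pos le have "real p ^ n * (\<Sum>i<n. f i) < real p ^ n * x"
    and "real p ^ n * x \<le> real p ^ n * (\<Sum>i<n. f i) + 1"
    by (auto simp: field_simps)
  ultimately show ?thesis
    by (simp add: ceiling_eq_iff)
qed

lemma nonterminating_expansion_unique:
  assumes p: "p \<ge> 2" and d: "nonterminating_expansion p x d" and e: "nonterminating_expansion p x e"
  shows "d = e"
proof (cases "x = 0")
  case True
  have z: "c i = 0" if "nonterminating_expansion p 0 c" for c i
  proof -
    have s: "(\<lambda>i. real (c i) / real p ^ (i + 1)) sums 0"
      using that by (simp add: nonterminating_expansion_def)
    hence "real (c i) / real p ^ (i + 1) = 0"
      using suminf_eq_zero_iff[of "\<lambda>i. real (c i) / real p ^ (i + 1)"]
      by (simp add: sums_iff)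
    thus ?thesis using p by simp
  qed
  show ?thesis
  proof
    fix i
    show "d i = e i" using z[of d i] z[of e i] d e True by simp
  qed
next
  case False
  have rec: "(\<Sum>i<Suc n. c i * p ^ (Suc n - 1 - i)) = p * (\<Sum>i<n. c i * p ^ (n - 1 - i)) + c n"
    for c :: "nat \<Rightarrow> nat" and n
  proof -
    have "(\<Sum>i<n. c i * p ^ (n - i)) = (\<Sum>i<n. p * (c i * p ^ (n - 1 - i)))"
    proof (rule sum.cong)
      fix i assume "i \<in> {..<n}"
      hence "n - i = Suc (n - 1 - i)" by simp
      thus "c i * p ^ (n - i) = p * (c i * p ^ (n - 1 - i))" by simp
    qed simp
    thus ?thesis by (simp add: sum_distrib_left)
  qed
  have eq: "(\<Sum>i<n. d i * p ^ (n - 1 - i)) = (\<Sum>i<n. e i * p ^ (n - 1 - i))" for n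
    using ceiling_eq_of_nonterminating_expansion[OF p d False, of n] ceiling_eq_of_nonterminating_expansion[OF p e False, of n]
    by linarith
  show ?thesis
  proof
    fix n
    have "p * (\<Sum>i<n. d i * p ^ (n - 1 - i)) + d n = p * (\<Sum>i<n. e i * p ^ (n - 1 - i)) + e n"
      using eq[of "Suc n"] unfolding rec .
    thus "d n = e n" unfolding eq[of n] by (rule add_left_imp_eq)
  qed
qed

lemma nonterminating_expansion_exists:
  assumes p: "p \<ge> 2" and x: "0 \<le> x" "x \<le> 1"
  shows "\<exists>d. nonterminating_expansion p x d"
proof (cases "x = 0")
  case True
  thus ?thesis by (intro exI[of _ "\<lambda>_. 0"]) (simp add: nonterminating_expansion_def)
next
  case False
  define c where "c = (\<lambda>i. \<lceil>real p ^ i * x\<rceil> - 1)"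
  define d where "d = (\<lambda>i. nat (c (Suc i) - int p * c i))"
  have c: "real_of_int (c i) < real p ^ i * x" "real p ^ i * x \<le> real_of_int (c i) + 1" for i
    unfolding c_def by linarith+
  have "real p * real_of_int (c i) < real p * (real p ^ i * x)"
    and "real p * (real p ^ i * x) \<le> real p * (real_of_int (c i) + 1)" for i
    using c[of i] p by (auto intro!: mult_left_mono)
  hence "real_of_int (int p * c i) < real_of_int (c (Suc i) + 1)"
    and "real_of_int (c (Suc i)) < real_of_int (int p * c i + int p)" for i
    using c[of "Suc i"] by (simp_all add: algebra_simps) (smt (verit))+
  hence b: "int p * c i \<le> c (Suc i)" "c (Suc i) < int p * c i + int p" for i
    by (meson of_int_less_iff zless_add1_eq zle_add1_eq_le)+
  have di: "int (d i) = c (Suc i) - int p * c i" for i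
    using b(1)[of i] by (simp add: d_def)
  have dlt: "d i \<in> {0..p - 1}" for i
    using b(2)[of i] di[of i] by auto
  have c0: "c 0 = 0" unfolding c_def using x False by (simp add: ceiling_eq_iff)
  have part: "(\<Sum>i<n. real (d i) / real p ^ (i + 1)) = real_of_int (c n) / real p ^ n" for n
  proof (induction n)
    case 0
    thus ?case by (simp add: c0)
  next
    case (Suc n)
    have "real (d n) = real_of_int (c (Suc n)) - real p * real_of_int (c n)"
      using di[of n] by (metis of_int_diff of_int_mult of_int_of_nat_eq)
    thus ?case using Suc p by (simp add: field_simps)
  qed
  have lo: "x - (1 / real p) ^ n \<le> real_of_int (c n) / real p ^ n"
    and hi: "real_of_int (c n) / real p ^ n < x" for n
    using c[of n] p by (simp_all add: power_one_over inverse_eq_divide pos_le_divide_eq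
      pos_divide_less_eq right_diff_distrib mult.commute)
  have "(\<lambda>n. (1 / real p) ^ n) \<longlonglongrightarrow> 0"
    using p by (intro LIMSEQ_power_zero) auto
  hence "(\<lambda>n. x - (1 / real p) ^ n) \<longlonglongrightarrow> x - 0"
    by (rule tendsto_diff[OF tendsto_const])
  hence lim: "(\<lambda>n. x - (1 / real p) ^ n) \<longlonglongrightarrow> x" by simp
  have "(\<lambda>n. real_of_int (c n) / real p ^ n) \<longlonglongrightarrow> x"
    by (rule tendsto_sandwich[OF always_eventually always_eventually lim tendsto_const])
      (use lo hi in \<open>blast intro: less_imp_le\<close>)+
  hence s: "(\<lambda>i. real (d i) / real p ^ (i + 1)) sums x"
    unfolding sums_def part .
  have "infinite {i. d i \<noteq> 0}"
  proof
    assume "finite {i. d i \<noteq> 0}"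
    then obtain N where N: "\<And>i. d i \<noteq> 0 \<Longrightarrow> i < N"
      by (metis (mono_tags, lifting) finite_nat_set_iff_bounded mem_Collect_eq)
    have "(\<lambda>i. real (d i) / real p ^ (i + 1)) sums (\<Sum>i<N. real (d i) / real p ^ (i + 1))"
      using N by (intro sums_finite) auto
    hence "x = real_of_int (c N) / real p ^ N"
      unfolding part by (rule sums_unique2[OF s])
    with hi[of N] show False by simp
  qed
  with s dlt show ?thesis by (auto simp: nonterminating_expansion_def)
qed

lemma digits_nonterminating_expansion:
  assumes "p \<ge> 2" "x \<in> {0..1}"
  shows "nonterminating_expansion p x (digits p x)"
proof -
  obtain d where d: "nonterminating_expansion p x d"
    using nonterminating_expansion_exists assms by auto
  show ?thesis
    unfolding digits_def
    by (rule theI[where P = "nonterminating_expansion p x", OF d]) (rule nonterminating_expansion_unique[OF assms(1) _ d])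
qed

end

theory Submission
  imports Defs
begin

text \<open>
  For windows of length \<open>1\<close> the inner limit says that the digits of \<open>x\<close>, a sequence of
  integers, converge; hence they are eventually equal to some digit \<open>k\<close>.  Every longer window
  far out then has mean \<open>k\<close>, so \<open>\<alpha> = k\<close>.  There are only countably many eventually constant
  digit sequences, and countable sets have Hausdorff dimension \<open>0\<close>.
\<close>

lemma digits_eqI:
  assumes "p \<ge> 2" "nonterminating_expansion p x d"
  shows "digits p x = d"
  unfolding digits_def
  by (rule the_equality, fact, rule nonterminating_expansion_unique[OF assms(1) _ assms(2)])

text \<open>Multiplying the series by \<open>p\<close> and dropping its first term gives the series
  of \<open>shift_map p x\<close>. Speaking of expansions instead of \<open>digits\<close> lets the
  result be iterated directly.\<close>

lemma nonterminating_expansion_shift_map: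
  assumes p: "p \<ge> 2" and d: "nonterminating_expansion p x d"
  shows "nonterminating_expansion p (shift_map p x) (\<lambda>i. d (Suc i))"
proof -
  define f where "f = (\<lambda>i. real (d i) / real p ^ (i + 1))"
  have "summable f"
    using d by (auto simp: nonterminating_expansion_def f_def sums_iff)
  hence "summable (\<lambda>i. real p * f (Suc i))"
    by (intro summable_mult) (simp add: summable_Suc_iff)
  moreover have "(\<lambda>i. real p * f (Suc i)) = (\<lambda>i. real (d (Suc i)) / real p ^ (i + 1))"
    using p by (auto simp: f_def)
  ultimately have sums: "(\<lambda>i. real (d (Suc i)) / real p ^ (i + 1)) sums shift_map p x"
    unfolding shift_map_def digits_eqI[OF p d] by (simp add: summable_sums)
  have "infinite {i. d (Suc i) \<noteq> 0}" if "shift_map p x \<noteq> 0"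
  proof -
    \<comment> \<open>The definition grants infinitely many nonzero digits only for nonzero
      \<open>x\<close>; for \<open>x = 0\<close> all digits vanish, and so would the shifted
      sum.\<close>
    have "x \<noteq> 0"
    proof
      assume "x = 0"
      moreover have "nonterminating_expansion p 0 (\<lambda>_. 0)"
        by (simp add: nonterminating_expansion_def)
      ultimately have "d = (\<lambda>_. 0)"
        using nonterminating_expansion_unique[OF p d] by simp
      with sums have "(\<lambda>_. 0) sums shift_map p x" by simp
      with that show False using sums_unique2 sums_zero by blast
    qed
    hence inf: "infinite {i. d i \<noteq> 0}"
      using d by (simp add: nonterminating_expansion_def)
    \<comment> \<open>The shift loses at most the index 0 from the support, so the support stays
      infinite.\<close>
    have "{i. d i \<noteq> 0} \<subseteq> insert 0 (Suc ` {i. d (Suc i) \<noteq> 0})"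
    proof
      fix i assume "i \<in> {i. d i \<noteq> 0}"
      thus "i \<in> insert 0 (Suc ` {i. d (Suc i) \<noteq> 0})" by (cases i) auto
    qed
    thus ?thesis using inf finite_subset by blast
  qed
  with sums d show ?thesis by (simp add: nonterminating_expansion_def)
qed

text \<open>Turns the windows of iterates into windows of the one sequence
  \<open>digits p x\<close>.\<close>

lemma digits_shift_map_funpow:
  assumes p: "p \<ge> 2" and x: "x \<in> {0..1}"
  shows "digits p ((shift_map p ^^ m) x) i = digits p x (i + m)"
proof -
  have "nonterminating_expansion p ((shift_map p ^^ m) x) (\<lambda>i. digits p x (i + m))"
  proof (induction m)
    case 0
    show ?case using digits_nonterminating_expansion[OF p x] by simp
  next
    case (Suc m)
    show ?case using nonterminating_expansion_shift_map[OF p Suc] by simp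
  qed
  from digits_eqI[OF p this] show ?thesis by simp
qed

lemma convergent_of_nat_eventually_constant:
  fixes d :: "nat \<Rightarrow> nat"
  assumes "(\<lambda>m. real (d m)) \<longlonglongrightarrow> l"
  shows "\<exists>k. \<forall>\<^sub>F m in sequentially. d m = k"
proof -
  \<comment> \<open>Distinct naturals are at distance at least 1, so the Cauchy bound 1 forces
    equality.\<close>
  obtain N where N: "\<And>m n. m \<ge> N \<Longrightarrow> n \<ge> N \<Longrightarrow> dist (real (d m)) (real (d n)) < 1"
    using metric_CauchyD[OF LIMSEQ_imp_Cauchy[OF assms], of 1] by auto
  have "d m = d N" if "m \<ge> N" for m
    using N[OF that order_refl] by (simp add: dist_real_def)
  thus ?thesis unfolding eventually_sequentially by blast
qed

text \<open>Serves both halves of the theorem: the value of \<alpha> gives emptiness, the constant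
  tail gives countability.\<close>

lemma Bstar_digits_eventually_constant:
  assumes p: "p \<ge> 2" and x: "x \<in> Bstar p \<alpha>"
  obtains k where "k \<in> {0..p - 1}" "\<alpha> = real k" "\<forall>\<^sub>F i in sequentially. digits p x i = k"
proof -
  have x01: "x \<in> {0..1}" using x by (simp add: Bstar_def)
  obtain L where
    L: "\<And>n. n \<ge> 1 \<Longrightarrow> (\<lambda>m. real (digit_sum p n ((shift_map p ^^ m) x)) / real n) \<longlonglongrightarrow> L n"
    and \<alpha>: "L \<longlonglongrightarrow> \<alpha>"
    using x unfolding Bstar_def has_moving_digit_mean_def by blast
  have window: "digit_sum p n ((shift_map p ^^ m) x) = (\<Sum>i<n. digits p x (i + m))" for n m
    by (simp add: digit_sum_def digits_shift_map_funpow[OF p x01])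
  have "(\<lambda>m. real (digits p x m)) \<longlonglongrightarrow> L 1"
    using L[of 1] by (simp add: window)
  then obtain k N where k: "\<And>i. i \<ge> N \<Longrightarrow> digits p x i = k"
    using convergent_of_nat_eventually_constant unfolding eventually_sequentially by blast
  \<comment> \<open>\<open>L 0\<close> is unconstrained, but the limit of \<open>L\<close> does not
    see it.\<close>
  have "L n = real k" if "n \<ge> 1" for n
  proof (rule LIMSEQ_unique[OF L[OF that]])
    have "\<forall>\<^sub>F m in sequentially. real (digit_sum p n ((shift_map p ^^ m) x)) / real n = real k"
      unfolding eventually_sequentially
      using that by (intro exI[of _ N]) (simp add: window k)
    thus "(\<lambda>m. real (digit_sum p n ((shift_map p ^^ m) x)) / real n) \<longlonglongrightarrow> real k"
      by (rule tendsto_eventually)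
  qed
  hence "L \<longlonglongrightarrow> real k"
    by (intro tendsto_eventually) (auto simp: eventually_sequentially)
  hence "\<alpha> = real k" using \<alpha> LIMSEQ_unique by blast
  moreover have "k \<in> {0..p - 1}"
    using digits_nonterminating_expansion[OF p x01] k[of N]
    by (metis nonterminating_expansion_def order_refl)
  ultimately show thesis
    using that k by (auto simp: eventually_sequentially)
qed

text \<open>Such a sequence is coded by a finite list, its prefix before the constant tail, and
  there are countably many lists.\<close>

lemma countable_eventually_constant:
  "countable {d :: nat \<Rightarrow> 'a::countable. \<forall>\<^sub>F i in sequentially. d i = k}"
proof -
  have "{d. \<forall>\<^sub>F i in sequentially. d i = k}
          \<subseteq> range (\<lambda>l i. if i < length l then l ! i else k)"
  proof
    fix d assume "d \<in> {d. \<forall>\<^sub>F i in sequentially. d i = k}"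
    then obtain N where "\<And>i. i \<ge> N \<Longrightarrow> d i = k"
      by (auto simp: eventually_sequentially)
    hence "d = (\<lambda>i. if i < length (map d [0..<N]) then map d [0..<N] ! i else k)"
      by auto
    thus "d \<in> range (\<lambda>l i. if i < length l then l ! i else k)" by blast
  qed
  thus ?thesis by (rule countable_subset) simp
qed

text \<open>Summing the series recovers \<open>x\<close> from its digits, so the set lies in the
  image of countably many sequences.\<close>

lemma countable_Bstar:
  assumes p: "p \<ge> 2"
  shows "countable (Bstar p \<alpha>)"
proof (rule countable_subset)
  let ?D = "\<Union>k. {d :: nat \<Rightarrow> nat. \<forall>\<^sub>F i in sequentially. d i = k}"
  show "Bstar p \<alpha> \<subseteq> (\<lambda>d. \<Sum>i. real (d i) / real p ^ (i + 1)) ` ?D"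
  proof
    fix x assume x: "x \<in> Bstar p \<alpha>"
    hence "x \<in> {0..1}" by (simp add: Bstar_def)
    from digits_nonterminating_expansion[OF p this]
    have "x = (\<Sum>i. real (digits p x i) / real p ^ (i + 1))"
      by (simp add: nonterminating_expansion_def sums_iff)
    moreover have "digits p x \<in> ?D"
      by (rule Bstar_digits_eventually_constant[OF p x]) auto
    ultimately show "x \<in> (\<lambda>d. \<Sum>i. real (d i) / real p ^ (i + 1)) ` ?D" by (rule image_eqI)
  qed
  show "countable ((\<lambda>d. \<Sum>i. real (d i) / real p ^ (i + 1)) ` ?D)"
    by (rule countable_image, rule countable_UN, simp, rule countable_eventually_constant)
qed

lemma hausdorff_measure_countable:
  fixes A :: "'a::metric_space set"
  assumes A: "countable A" and s: "s > 0"
  shows "hausdorff_measure s A = 0"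
proof -
  have "hausdorff_premeasure s \<delta> A = 0" if "\<delta> > 0" for \<delta>
  proof -
    \<comment> \<open>Singletons have diameter 0, and \<open>0 powr s = 0\<close>. Where the
      enumeration of \<open>A\<close> runs out, \<open>from_nat_into\<close> returns a default
      value, which adds another singleton of cost 0.\<close>
    define U where "U = (\<lambda>i. {from_nat_into A i})"
    have "A \<subseteq> (\<Union>i. U i)"
      unfolding U_def using from_nat_into_surj[OF A] by fastforce
    moreover have "\<forall>i. bounded (U i) \<and> diameter (U i) \<le> \<delta>"
      using that by (simp add: U_def)
    ultimately have "hausdorff_premeasure s \<delta> A \<le> (\<Sum>i. ennreal (diam_powr s (U i)))"
      unfolding hausdorff_premeasure_def by (intro INF_lower) simp
    also have "\<dots> = 0"
      using s by (simp add: diam_powr_def U_def)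
    finally show ?thesis by simp
  qed
  thus ?thesis by (simp add: hausdorff_measure_def)
qed

text \<open>Every \<open>e > 0\<close> is an admissible exponent, so the infimum is 0; the exponent
  0 itself gives counting measure and is not admissible for nonempty \<open>A\<close>.\<close>

lemma hausdorff_dim_countable:
  fixes A :: "'a::metric_space set"
  assumes "countable A"
  shows "hausdorff_dim A = 0"
proof -
  have "hausdorff_dim A \<le> 0 + ennreal e" if "e > 0" for e
    unfolding hausdorff_dim_def add_0
    using that hausdorff_measure_countable[OF assms that] by (intro Inf_lower) simp
  hence "hausdorff_dim A \<le> 0" by (rule ennreal_le_epsilon)
  thus ?thesis by simp
qed

theorem theorem5p3:
  fixes p :: nat and \<alpha> :: real
  assumes "p \<ge> 2" and "0 \<le> \<alpha>" and "\<alpha> \<le> real p - 1"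
  shows "(\<alpha> \<in> real ` {0..p - 1} \<longrightarrow> countable (Bstar p \<alpha>)) \<and>
         (\<alpha> \<notin> real ` {0..p - 1} \<longrightarrow> Bstar p \<alpha> = {}) \<and>
         hausdorff_dim (Bstar p \<alpha>) = 0"
proof (intro conjI impI)
  show "countable (Bstar p \<alpha>)" by (rule countable_Bstar[OF assms(1)])
  thus "hausdorff_dim (Bstar p \<alpha>) = 0" by (rule hausdorff_dim_countable)
  show "Bstar p \<alpha> = {}" if "\<alpha> \<notin> real ` {0..p - 1}"
    using Bstar_digits_eventually_constant[OF assms(1)] that by blast
qed

end
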